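(* Let $\mathcal{L}_0=(L_0,\prec_{\mathcal{L}_0})$ and $\mathcal{L}_1=(L_1,\prec_{\mathcal{L}_1})$ be computable linear orders and let $C\subseteq\mathbb{N}$ be cohesive. Then (1) $\Pi_C(\mathcal{L}_0+\mathcal{L}_1)\cong\Pi_C\mathcal{L}_0+\Pi_C\mathcal{L}_1$; (2) $\Pi_C(\mathcal{L}_0\mathcal{L}_1)\cong(\Pi_C\mathcal{L}_0)(\Pi_C\mathcal{L}_1)$; and (3) $\Pi_C(\mathcal{L}_0^* )\cong(\Pi_C\mathcal{L}_0)^*$.
   Context: A set $C\subseteq\mathbb{N}$ is cohesive if it is infinite and for every c.e. set $W$, either $C\setminus W$ or $C\cap W$ is finite. Write $X\subseteq^* Y$ if $X\setminus Y$ is finite. For a computable linear order $\mathcal{L}=(L,\prec_{\mathcal{L}})$ (computable domain $L\subseteq\mathbb{N}$, computable order), the cohesive power $\Pi_C\mathcal{L}$ has as elements the classes $[\varphi]$ of partial computable $\varphi\colon\mathbb{N}\to L$ with $C\subseteq^*\mathrm{dom}(\varphi)$ under $\varphi=_C\psi$ iff $C\subseteq^*\{x:\varphi(x)\downarrow=\psi(x)\downarrow\}$, ordered by $[\varphi]\prec[\psi]$ iff $C\subseteq^*\{x:\varphi(x)\downarrow,\psi(x)\downarrow,\varphi(x)\prec_{\mathcal{L}}\psi(x)\}$. Sum: $\mathcal{L}_0+\mathcal{L}_1$ has domain $(\{0\}\times L_0)\cup(\{1\}\times L_1)$ (coded into $\mathbb{N}$ via the standard computable pairing function $\langle\cdot,\cdot\rangle$),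 with $(i,x)\prec(j,y)$ iff $i<j$ or ($i=j$ and $x\prec_{\mathcal{L}_i}y$). Product: $\mathcal{L}_0\mathcal{L}_1$ has domain $L_1\times L_0$ (coded via pairing), with $(x,a)\prec(y,b)$ iff $x\prec_{\mathcal{L}_1}y$ or ($x=y$ and $a\prec_{\mathcal{L}_0}b$). Reverse: $\mathcal{L}_0^*$ has the same domain with the order reversed. The same operations are used on the (abstract) linear orders on the right-hand sides. *)

theory Defs
  imports Main "HOL-Library.Nat_Bijection"
begin

section \<open>Partial computable functions\<close>

text \<open>
  Codes for Kleene's partial recursive functions. Codes carry no arity: a code is evaluated on
  argument lists of any length, and the result is undefined if an argument it needs is missing.
\<close>

datatype rec_code =
    Zero
  | Succ
  | Proj nat
  | Comp rec_code "rec_code list"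
  | Prec rec_code rec_code
  | Mu rec_code

text \<open>
  \<^const>\<open>None\<close> stands for divergence. Composition is strict: all inner values have to converge.
  \<open>Prec f g\<close> recurses on the first argument, and \<open>Mu f\<close> minimises over the first argument of \<open>f\<close>,
  requiring \<open>f\<close> to converge to a nonzero value at all smaller arguments.
\<close>

fun rec_eval :: "rec_code \<Rightarrow> nat list \<Rightarrow> nat option" where
  "rec_eval Zero xs = Some 0"
| "rec_eval Succ xs = (case xs of [] \<Rightarrow> None | x # _ \<Rightarrow> Some (Suc x))"
| "rec_eval (Proj i) xs = (if i < length xs then Some (xs ! i) else None)"
| "rec_eval (Comp f gs) xs =
     (if \<forall>g \<in> set gs. rec_eval g xs \<noteq> None
      then rec_eval f (map (\<lambda>g. the (rec_eval g xs)) gs) else None)"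
| "rec_eval (Prec f g) xs =
     (case xs of [] \<Rightarrow> None
      | n # ys \<Rightarrow> rec_nat (rec_eval f ys)
          (\<lambda>m r. Option.bind r (\<lambda>y. rec_eval g (m # y # ys))) n)"
| "rec_eval (Mu f) xs =
     (if \<exists>n. rec_eval f (n # xs) = Some 0 \<and> (\<forall>m<n. rec_eval f (m # xs) \<noteq> None)
      then Some (LEAST n. rec_eval f (n # xs) = Some 0) else None)"

definition partial_computable :: "(nat \<Rightarrow> nat option) \<Rightarrow> bool" where
  "partial_computable \<phi> \<longleftrightarrow> (\<exists>f. \<forall>x. rec_eval f [x] = \<phi> x)"

definition ce_set :: "nat set \<Rightarrow> bool" where
  "ce_set W \<longleftrightarrow> (\<exists>\<phi>. partial_computable \<phi> \<and> W = dom \<phi>)"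

definition computable_set :: "nat set \<Rightarrow> bool" where
  "computable_set A \<longleftrightarrow> (\<exists>f. \<forall>x. rec_eval f [x] = Some (if x \<in> A then 1 else 0))"

definition computable_rel :: "nat rel \<Rightarrow> bool" where
  "computable_rel r \<longleftrightarrow> (\<exists>f. \<forall>x y. rec_eval f [x, y] = Some (if (x, y) \<in> r then 1 else 0))"


section \<open>Cohesive sets\<close>

definition almost_subset :: "'a set \<Rightarrow> 'a set \<Rightarrow> bool"  (infix "\<subseteq>\<^sup>*" 50) where
  "X \<subseteq>\<^sup>* Y \<longleftrightarrow> finite (X - Y)"

definition cohesive :: "nat set \<Rightarrow> bool" where
  "cohesive C \<longleftrightarrow> infinite C \<and> (\<forall>W. ce_set W \<longrightarrow> finite (C - W) \<or> finite (C \<inter> W))"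


section \<open>Linear orders\<close>

text \<open>
  Orders are strict, as a set together with a relation on it. The set is kept explicitly because
  the field of a strict order on one point is empty.
\<close>

record 'a ord_struct =
  Dom :: "'a set"
  Less :: "'a rel"

definition is_linear_order :: "'a ord_struct \<Rightarrow> bool" where
  "is_linear_order L \<longleftrightarrow>
     Less L \<subseteq> Dom L \<times> Dom L \<and> strict_linear_order_on (Dom L) (Less L)"

definition computable_linear_order :: "nat ord_struct \<Rightarrow> bool" where
  "computable_linear_order L \<longleftrightarrow>
     is_linear_order L \<and> computable_set (Dom L) \<and> computable_rel (Less L)"

definition ord_isomorphic :: "'a ord_struct \<Rightarrow> 'b ord_struct \<Rightarrow> bool"  (infix "\<cong>\<^sub>o" 50) where
  "L \<cong>\<^sub>o M \<longleftrightarrow>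
     (\<exists>f. bij_betw f (Dom L) (Dom M) \<and>
          (\<forall>x \<in> Dom L. \<forall>y \<in> Dom L. (x, y) \<in> Less L \<longleftrightarrow> (f x, f y) \<in> Less M))"

definition ord_sum :: "'a ord_struct \<Rightarrow> 'a ord_struct \<Rightarrow> (nat \<times> 'a) ord_struct" where
  "ord_sum L0 L1 =
     (let D = ({0} \<times> Dom L0) \<union> ({1} \<times> Dom L1) in
      \<lparr> Dom = D,
        Less = {((i, x), (j, y)). (i, x) \<in> D \<and> (j, y) \<in> D \<and>
                  (i < j \<or> (i = j \<and> (x, y) \<in> Less (if i = 0 then L0 else L1)))} \<rparr>)"

text \<open>The product replaces every point of \<open>L1\<close> by a copy of \<open>L0\<close>.\<close>

definition ord_prod :: "'a ord_struct \<Rightarrow> 'b ord_struct \<Rightarrow> ('b \<times> 'a) ord_struct" where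
  "ord_prod L0 L1 =
     (let D = Dom L1 \<times> Dom L0 in
      \<lparr> Dom = D,
        Less = {((x, a), (y, b)). (x, a) \<in> D \<and> (y, b) \<in> D \<and>
                  ((x, y) \<in> Less L1 \<or> (x = y \<and> (a, b) \<in> Less L0))} \<rparr>)"

definition ord_reverse :: "'a ord_struct \<Rightarrow> 'a ord_struct" where
  "ord_reverse L = \<lparr> Dom = Dom L, Less = (Less L)\<inverse> \<rparr>"

text \<open>
  Sums and products of computable orders become orders on natural numbers again by means of the
  Cantor pairing function \<^const>\<open>prod_encode\<close>.
\<close>

definition ord_code :: "(nat \<times> nat) ord_struct \<Rightarrow> nat ord_struct" where
  "ord_code L =
     \<lparr> Dom = prod_encode ` Dom L,
       Less = {(prod_encode p, prod_encode q) | p q. (p, q) \<in> Less L} \<rparr>"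


section \<open>Cohesive powers\<close>

definition cp_funs :: "nat set \<Rightarrow> nat ord_struct \<Rightarrow> (nat \<Rightarrow> nat option) set" where
  "cp_funs C L = {\<phi>. partial_computable \<phi> \<and> ran \<phi> \<subseteq> Dom L \<and> C \<subseteq>\<^sup>* dom \<phi>}"

definition cp_eq :: "nat set \<Rightarrow> nat ord_struct \<Rightarrow> (nat \<Rightarrow> nat option) rel" where
  "cp_eq C L = {(\<phi>, \<psi>). \<phi> \<in> cp_funs C L \<and> \<psi> \<in> cp_funs C L \<and>
                         C \<subseteq>\<^sup>* {x. \<exists>a. \<phi> x = Some a \<and> \<psi> x = Some a}}"

definition cohesive_power :: "nat set \<Rightarrow> nat ord_struct \<Rightarrow> (nat \<Rightarrow> nat option) set ord_struct" where
  "cohesive_power C L =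
     \<lparr> Dom = cp_funs C L // cp_eq C L,
       Less = {(cp_eq C L `` {\<phi>}, cp_eq C L `` {\<psi>}) | \<phi> \<psi>.
                 \<phi> \<in> cp_funs C L \<and> \<psi> \<in> cp_funs C L \<and>
                 C \<subseteq>\<^sup>* {x. \<exists>a b. \<phi> x = Some a \<and> \<psi> x = Some b \<and> (a, b) \<in> Less L}} \<rparr>"

end

theory Submission
  imports Defs Complex_Main
begin

text \<open>
  A property of partial computable functions that holds almost everywhere on \<open>C\<close> is a property that
  holds eventually in the filter of sets containing almost all of \<open>C\<close>. Cohesiveness says that this
  filter decides every c.e. set. So a partial computable function into \<open>L0 + L1\<close> eventually stays in
  one summand, and two partial computable functions are eventually equal or eventually different,
  which splits the lexicographic order on a product. The isomorphisms then act on representatives by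
  pairing with a constant, by pairing, and as the identity.
\<close>

section \<open>Computability\<close>

lemma partial_computable_bind:
  assumes "partial_computable \<phi>" "partial_computable h"
  shows "partial_computable (\<lambda>x. Option.bind (\<phi> x) h)"
proof -
  obtain e f where "\<forall>x. rec_eval e [x] = \<phi> x" "\<forall>x. rec_eval f [x] = h x"
    using assms unfolding partial_computable_def by blast
  then have "\<forall>x. rec_eval (Comp f [e]) [x] = Option.bind (\<phi> x) h"
    by (auto split: bind_split)
  then show ?thesis
    unfolding partial_computable_def by blast
qed

text \<open>The outer code \<open>f\<close> may itself diverge on \<open>[a, b]\<close>. This lets
  partial codes such as \<open>eq_guard_code\<close> be applied pointwise.\<close>

lemma partial_computable_bind2:
  assumes "partial_computable \<phi>" "partial_computable \<psi>" "\<And>a b. rec_eval f [a, b] = h a b"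
  shows "partial_computable (\<lambda>x. Option.bind (\<phi> x) (\<lambda>a. Option.bind (\<psi> x) (h a)))"
proof -
  obtain d e where "\<forall>x. rec_eval d [x] = \<phi> x" "\<forall>x. rec_eval e [x] = \<psi> x"
    using assms unfolding partial_computable_def by blast
  then have "\<forall>x. rec_eval (Comp f [d, e]) [x] =
      Option.bind (\<phi> x) (\<lambda>a. Option.bind (\<psi> x) (h a))"
    using assms(3) by (auto split: bind_split)
  then show ?thesis
    unfolding partial_computable_def by blast
qed

lemma partial_computable_const: "partial_computable (\<lambda>_. Some n)"
proof (induction n)
  case 0
  have "\<forall>x. rec_eval Zero [x] = Some 0" by simp
  then show ?case unfolding partial_computable_def by blast
next
  case (Suc n)
  have "\<forall>x. rec_eval Succ [x] = Some (Suc x)" by simp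
  then have "partial_computable (\<lambda>x. Some (Suc x))" unfolding partial_computable_def by blast
  from partial_computable_bind[OF Suc this] show ?case by simp
qed

section \<open>Recursive codes for the Cantor pairing function and its inverse\<close>

definition add_code :: rec_code where
  "add_code = Prec (Proj 0) (Comp Succ [Proj 1])"

lemma rec_eval_add_code [simp]: "rec_eval add_code [m, n] = Some (m + n)"
  by (induction m) (auto simp: add_code_def)

definition pred_code :: rec_code where
  "pred_code = Prec Zero (Proj 0)"

lemma rec_eval_pred_code [simp]: "rec_eval pred_code [n] = Some (n - 1)"
  by (induction n) (auto simp: pred_code_def)

text \<open>The arguments are swapped because \<^const>\<open>Prec\<close> recurses on the first one.\<close>

definition rsub_code :: rec_code where
  "rsub_code = Prec (Proj 0) (Comp pred_code [Proj 1])"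

lemma rec_eval_rsub_code [simp]: "rec_eval rsub_code [m, n] = Some (n - m)"
  by (induction m) (auto simp: rsub_code_def)

definition triangle_code :: rec_code where
  "triangle_code = Prec Zero (Comp add_code [Comp Succ [Proj 0], Proj 1])"

lemma rec_eval_triangle_code [simp]: "rec_eval triangle_code [n] = Some (triangle n)"
  by (induction n) (auto simp: triangle_code_def)

definition encode_code :: rec_code where
  "encode_code = Comp add_code [Comp triangle_code [add_code], Proj 0]"

lemma rec_eval_encode_code [simp]: "rec_eval encode_code [m, n] = Some (prod_encode (m, n))"
  by (simp add: encode_code_def prod_encode_def)

text \<open>The diagonal \<open>m + n\<close> of the code \<open>z\<close> of \<open>(m, n)\<close> is the least \<open>s\<close> with \<open>z < triangle (Suc s)\<close>.\<close>

definition diag_code :: rec_code where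
  "diag_code = Mu (Comp rsub_code [Comp triangle_code [Comp Succ [Proj 0]], Comp Succ [Proj 1]])"

lemma triangle_mono: "m \<le> n \<Longrightarrow> triangle m \<le> triangle n"
  by (induction rule: dec_induct) auto

lemma rec_eval_diag_code: "rec_eval diag_code [prod_encode (m, n)] = Some (m + n)"
proof -
  let ?z = "prod_encode (m, n)"
  \<comment> \<open>The code is \<open>triangle (m + n) + m\<close>, and the next triangular number
    exceeds \<open>triangle (m + n)\<close> by \<open>Suc (m + n) > m\<close>.\<close>
  have 1: "?z < triangle (Suc (m + n))" by (simp add: prod_encode_def)
  have 2: "m + n \<le> s" if "?z < triangle (Suc s)" for s
  proof (rule ccontr)
    assume "\<not> m + n \<le> s"
    then have "triangle (Suc s) \<le> triangle (m + n)" by (intro triangle_mono) simp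
    with that show False by (simp add: prod_encode_def)
  qed
  have "(LEAST s. ?z < triangle (Suc s)) = m + n"
    by (rule Least_equality) (use 1 2 in auto)
  \<comment> \<open>The body of \<open>diag_code\<close> is total with value
    \<open>Suc z - triangle (Suc s)\<close>, which vanishes iff \<open>z < triangle (Suc s)\<close>.
    Keeping \<open>triangle_Suc\<close> folded preserves the form of the facts above.\<close>
  then show ?thesis
    using 1 by (auto simp: diag_code_def Suc_le_eq simp del: triangle_Suc)
qed

text \<open>Since the code is \<open>triangle (m + n) + m\<close>, subtracting the triangular number
  of the diagonal leaves \<open>m\<close>; the diagonal minus \<open>m\<close> then gives
  \<open>n\<close>.\<close>

definition fst_code :: rec_code where
  "fst_code = Comp rsub_code [Comp triangle_code [diag_code], Proj 0]"

lemma rec_eval_fst_code: "rec_eval fst_code [z] = Some (fst (prod_decode z))"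
proof -
  obtain m n where "z = prod_encode (m, n)" by (metis prod_decode_inverse surj_pair)
  then show ?thesis
    \<comment> \<open>\<open>prod_encode\<close> is unfolded only in the second call, so that
      \<open>rec_eval_diag_code\<close> still matches in the first.\<close>
    by (simp add: fst_code_def rec_eval_diag_code) (simp add: prod_encode_def)
qed

lemma rec_eval_snd_code:
  "rec_eval (Comp rsub_code [fst_code, diag_code]) [z] = Some (snd (prod_decode z))"
proof -
  obtain m n where "z = prod_encode (m, n)" by (metis prod_decode_inverse surj_pair)
  then show ?thesis
    by (simp add: rec_eval_fst_code rec_eval_diag_code)
qed

section \<open>Partial computable operations on coded pairs\<close>

lemma partial_computable_map_fst:
  assumes "partial_computable \<phi>"
  shows "partial_computable (\<lambda>x. map_option (fst \<circ> prod_decode) (\<phi> x))"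
proof -
  have "partial_computable (\<lambda>z. Some (fst (prod_decode z)))"
    unfolding partial_computable_def using rec_eval_fst_code by blast
  from partial_computable_bind[OF assms this] show ?thesis
    by (rule back_subst[of partial_computable]) (auto simp: fun_eq_iff split: bind_split)
qed

lemma partial_computable_map_snd:
  assumes "partial_computable \<phi>"
  shows "partial_computable (\<lambda>x. map_option (snd \<circ> prod_decode) (\<phi> x))"
proof -
  have "partial_computable (\<lambda>z. Some (snd (prod_decode z)))"
    unfolding partial_computable_def using rec_eval_snd_code by blast
  from partial_computable_bind[OF assms this] show ?thesis
    by (rule back_subst[of partial_computable]) (auto simp: fun_eq_iff split: bind_split)
qed

definition pair_fun :: "(nat \<Rightarrow> nat option) \<Rightarrow> (nat \<Rightarrow> nat option) \<Rightarrow> nat \<Rightarrow> nat option" where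
  "pair_fun \<phi> \<psi> x =
     Option.bind (\<phi> x) (\<lambda>a. Option.bind (\<psi> x) (\<lambda>b. Some (prod_encode (a, b))))"

lemma pair_fun_eq_Some:
  "pair_fun \<phi> \<psi> x = Some z \<longleftrightarrow> (\<exists>a b. \<phi> x = Some a \<and> \<psi> x = Some b \<and> z = prod_encode (a, b))"
  by (auto simp: pair_fun_def bind_eq_Some_conv)

lemma partial_computable_pair_fun:
  assumes "partial_computable \<phi>" "partial_computable \<psi>"
  shows "partial_computable (pair_fun \<phi> \<psi>)"
  using partial_computable_bind2[OF assms rec_eval_encode_code]
  by (simp add: pair_fun_def[abs_def])

text \<open>\<open>Mu (Proj 1)\<close> diverges exactly at nonzero arguments.\<close>

definition eq_guard_code :: rec_code where
  "eq_guard_code = Comp (Mu (Proj 1))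
     [Comp add_code [rsub_code, Comp rsub_code [Proj 1, Proj 0]]]"

lemma rec_eval_eq_guard_code: "rec_eval eq_guard_code [a, b] = (if a = b then Some 0 else None)"
  by (auto simp: eq_guard_code_def)

lemma partial_computable_eq_guard:
  assumes "partial_computable \<phi>" "partial_computable \<psi>"
  shows "partial_computable
    (\<lambda>x. Option.bind (\<phi> x) (\<lambda>a. Option.bind (\<psi> x) (\<lambda>b. if a = b then Some 0 else None)))"
  by (rule partial_computable_bind2[OF assms rec_eval_eq_guard_code])

text \<open>Agreement is semidecidable: run both computations and diverge unless their values
  coincide. Cohesiveness is applied to this set in the proof for products.\<close>

lemma ce_set_agree:
  assumes "partial_computable \<phi>" "partial_computable \<psi>"
  shows "ce_set {x. \<exists>a. \<phi> x = Some a \<and> \<psi> x = Some a}"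
proof -
  let ?g = "\<lambda>x. Option.bind (\<phi> x) (\<lambda>a. Option.bind (\<psi> x) (\<lambda>b. if a = b then Some (0::nat) else None))"
  have "{x. \<exists>a. \<phi> x = Some a \<and> \<psi> x = Some a} = dom ?g"
    by (auto simp: dom_def bind_eq_Some_conv)
  then show ?thesis
    using partial_computable_eq_guard[OF assms] unfolding ce_set_def by blast
qed

text \<open>Divergence on values with another tag makes the places with tag \<open>i\<close> the
  domain of a partial computable function, hence a c.e. set.\<close>

definition component_fun :: "nat \<Rightarrow> (nat \<Rightarrow> nat option) \<Rightarrow> nat \<Rightarrow> nat option" where
  "component_fun i \<phi> x =
     Option.bind (\<phi> x) (\<lambda>z. if fst (prod_decode z) = i then Some (snd (prod_decode z)) else None)"

lemma component_fun_eq_Some: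
  "component_fun i \<phi> x = Some a \<longleftrightarrow> \<phi> x = Some (prod_encode (i, a))"
proof -
  have "z = prod_encode (i, a) \<longleftrightarrow> fst (prod_decode z) = i \<and> snd (prod_decode z) = a" for z
    by (metis fst_conv prod.collapse prod_decode_inverse prod_encode_inverse snd_conv)
  then show ?thesis
    by (cases "\<phi> x") (simp_all add: component_fun_def)
qed

lemma partial_computable_component_fun:
  assumes "partial_computable \<phi>"
  shows "partial_computable (component_fun i \<phi>)"
proof -
  \<comment> \<open>\<open>Proj 0\<close> keeps the second coordinate and discards the value of the
    guard, which acts only by diverging when the tag is not \<open>i\<close>.\<close>
  have "rec_eval (Proj 0) [a, b] = Some a" for a b by simp
  from partial_computable_bind2[OF partial_computable_map_snd[OF assms]
      partial_computable_eq_guard[OF partial_computable_map_fst[OF assms]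
        partial_computable_const[of i]] this]
  show ?thesis
    by (rule back_subst[of partial_computable])
      (auto simp: component_fun_def fun_eq_iff split: bind_split)
qed


section \<open>Cohesive powers on representatives\<close>

text \<open>In this form finite exceptional sets never appear explicitly: they are absorbed by the
  rules for \<open>eventually\<close>.\<close>

definition cohesive_filter :: "nat set \<Rightarrow> nat filter" where
  "cohesive_filter C = inf cofinite (principal C)"

lemma almost_subset_iff_eventually:
  "C \<subseteq>\<^sup>* A \<longleftrightarrow> (\<forall>\<^sub>F x in cohesive_filter C. x \<in> A)"
proof -
  have "{x. \<not> (x \<in> C \<longrightarrow> x \<in> A)} = C - A" by auto
  then show ?thesis
    by (simp add: almost_subset_def cohesive_filter_def eventually_inf_principal eventually_cofinite)
qed

text \<open>This is the infinitude of \<open>C\<close>. It makes a proposition that does not depend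
  on \<open>x\<close> hold eventually only if it is true.\<close>

lemma cohesive_filter_neq_bot:
  assumes "cohesive C"
  shows "cohesive_filter C \<noteq> bot"
  using assms
  by (simp add: trivial_limit_def cohesive_filter_def eventually_inf_principal eventually_cofinite
      cohesive_def)

text \<open>If \<open>C \<inter> W\<close> is finite, almost all of \<open>C\<close> lies in the
  complement of \<open>W\<close>, whether or not that complement is c.e.\<close>

lemma cohesive_decides:
  assumes "cohesive C" "ce_set W"
  shows "(\<forall>\<^sub>F x in cohesive_filter C. x \<in> W) \<or> (\<forall>\<^sub>F x in cohesive_filter C. x \<notin> W)"
proof -
  have "C - - W = C \<inter> W" by auto
  then have "C \<subseteq>\<^sup>* W \<or> C \<subseteq>\<^sup>* - W"
    using assms by (auto simp: cohesive_def almost_subset_def)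
  then show ?thesis by (simp add: almost_subset_iff_eventually)
qed

section \<open>Classes and their order in terms of the filter\<close>

lemma cp_funs_iff:
  "\<phi> \<in> cp_funs C L \<longleftrightarrow> partial_computable \<phi> \<and> (\<forall>x a. \<phi> x = Some a \<longrightarrow> a \<in> Dom L) \<and>
     (\<forall>\<^sub>F x in cohesive_filter C. \<exists>a. \<phi> x = Some a)"
  by (auto simp: cp_funs_def almost_subset_iff_eventually ran_def dom_def)

lemma cp_funs_eventually:
  assumes "\<phi> \<in> cp_funs C L"
  shows "\<forall>\<^sub>F x in cohesive_filter C. \<exists>a. \<phi> x = Some a \<and> a \<in> Dom L"
  using assms unfolding cp_funs_iff by (auto elim: eventually_mono)

lemma cp_eq_iff:
  "(\<phi>, \<psi>) \<in> cp_eq C L \<longleftrightarrow> \<phi> \<in> cp_funs C L \<and> \<psi> \<in> cp_funs C L \<and>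
     (\<forall>\<^sub>F x in cohesive_filter C. \<exists>a. \<phi> x = Some a \<and> \<psi> x = Some a)"
  by (simp add: cp_eq_def almost_subset_iff_eventually)

lemma equiv_cp_eq: "equiv (cp_funs C L) (cp_eq C L)"
proof (rule equivI)
  show "cp_eq C L \<subseteq> cp_funs C L \<times> cp_funs C L"
    by (auto simp: cp_eq_iff)
  show "refl_on (cp_funs C L) (cp_eq C L)"
    by (auto simp: refl_on_def cp_eq_iff cp_funs_iff)
  show "sym (cp_eq C L)"
    by (auto simp: sym_def cp_eq_iff elim: eventually_mono)
  show "trans (cp_eq C L)"
    by (auto simp: trans_def cp_eq_iff elim: eventually_elim2)
qed

lemma cp_class_eq_iff:
  assumes "\<phi> \<in> cp_funs C L" "\<psi> \<in> cp_funs C L"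
  shows "cp_eq C L `` {\<phi>} = cp_eq C L `` {\<psi>} \<longleftrightarrow>
    (\<forall>\<^sub>F x in cohesive_filter C. \<exists>a. \<phi> x = Some a \<and> \<psi> x = Some a)"
  using eq_equiv_class_iff[OF equiv_cp_eq assms] assms by (simp add: cp_eq_iff)

lemma Dom_cohesive_power:
  "Dom (cohesive_power C L) = (\<lambda>\<phi>. cp_eq C L `` {\<phi>}) ` cp_funs C L"
  by (auto simp: cohesive_power_def quotient_def)

text \<open>\<open>Less\<close> only asks for some representatives that are eventually ordered.
  Representatives of one class agree eventually, so any others may replace them.\<close>

lemma Less_cohesive_power_iff:
  assumes "\<phi> \<in> cp_funs C L" "\<psi> \<in> cp_funs C L"
  shows "(cp_eq C L `` {\<phi>}, cp_eq C L `` {\<psi>}) \<in> Less (cohesive_power C L) \<longleftrightarrow>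
    (\<forall>\<^sub>F x in cohesive_filter C. \<exists>a b. \<phi> x = Some a \<and> \<psi> x = Some b \<and> (a, b) \<in> Less L)"
    (is "?l \<longleftrightarrow> ?r")
proof
  assume ?l
  then obtain \<phi>' \<psi>' where *: "\<phi>' \<in> cp_funs C L" "\<psi>' \<in> cp_funs C L"
      "cp_eq C L `` {\<phi>} = cp_eq C L `` {\<phi>'}" "cp_eq C L `` {\<psi>} = cp_eq C L `` {\<psi>'}"
      "\<forall>\<^sub>F x in cohesive_filter C. \<exists>a b. \<phi>' x = Some a \<and> \<psi>' x = Some b \<and> (a, b) \<in> Less L"
    by (auto simp: cohesive_power_def almost_subset_iff_eventually)
  have "\<forall>\<^sub>F x in cohesive_filter C. \<exists>a. \<phi> x = Some a \<and> \<phi>' x = Some a"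
    "\<forall>\<^sub>F x in cohesive_filter C. \<exists>a. \<psi> x = Some a \<and> \<psi>' x = Some a"
    using * assms by (simp_all add: cp_class_eq_iff)
  with *(5) show ?r by eventually_elim auto
next
  assume ?r
  then show ?l
    using assms by (auto simp: cohesive_power_def almost_subset_iff_eventually)
qed

text \<open>If \<open>p\<close> and \<open>q\<close> identify and compare the same elements of
  \<open>A\<close>, then sending \<open>p a\<close> to \<open>q a\<close> is well defined and an
  isomorphism. Maps on equivalence classes thus need no separate treatment.\<close>

lemma ord_isomorphic_via_representatives:
  assumes p: "p ` A = Dom M" and q: "q ` A = Dom N"
    and eq: "\<And>a b. a \<in> A \<Longrightarrow> b \<in> A \<Longrightarrow> p a = p b \<longleftrightarrow> q a = q b"
    and less: "\<And>a b. a \<in> A \<Longrightarrow> b \<in> A \<Longrightarrow> (p a, p b) \<in> Less M \<longleftrightarrow> (q a, q b) \<in> Less N"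
  shows "M \<cong>\<^sub>o N"
proof -
  define f where "f = q \<circ> inv_into A p"
  \<comment> \<open>\<open>inv_into\<close> may choose a representative other than \<open>a\<close>;
    by \<open>eq\<close> it has the same image under \<open>q\<close>.\<close>
  have f: "f (p a) = q a" if "a \<in> A" for a
    using that eq[of "inv_into A p (p a)" a]
    by (simp add: f_def inv_into_into f_inv_into_f)
  have "inj_on f (Dom M)"
    unfolding p[symmetric] by (rule inj_onI) (auto simp: f eq)
  moreover have "f ` Dom M = Dom N"
    unfolding p[symmetric] q[symmetric] image_image by (simp add: f)
  ultimately have "bij_betw f (Dom M) (Dom N)"
    by (simp add: bij_betw_def)
  moreover have "\<forall>x \<in> Dom M. \<forall>y \<in> Dom M. (x, y) \<in> Less M \<longleftrightarrow> (f x, f y) \<in> Less N"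
    unfolding p[symmetric] by (simp add: f less)
  ultimately show ?thesis
    unfolding ord_isomorphic_def by blast
qed

lemma Less_ord_code_iff:
  "(prod_encode p, prod_encode q) \<in> Less (ord_code L) \<longleftrightarrow> (p, q) \<in> Less L"
  by (cases p; cases q) (auto simp: ord_code_def)

lemma Dom_ord_code_iff: "prod_encode p \<in> Dom (ord_code L) \<longleftrightarrow> p \<in> Dom L"
  by (auto simp: ord_code_def)

lemma Dom_ord_codeE:
  assumes "z \<in> Dom (ord_code L)"
  obtains i a where "z = prod_encode (i, a)" "(i, a) \<in> Dom L"
  using assms by (auto simp: ord_code_def)


section \<open>Sums, products and reverses\<close>

lemma Dom_ord_sum_iff:
  "(i, x) \<in> Dom (ord_sum L0 L1) \<longleftrightarrow> i \<in> {0, 1} \<and> x \<in> Dom (if i = 0 then L0 else L1)"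
  by (auto simp: ord_sum_def)

lemma Less_ord_sum_iff:
  assumes "(i, x) \<in> Dom (ord_sum L0 L1)" "(j, y) \<in> Dom (ord_sum L0 L1)"
  shows "((i, x), (j, y)) \<in> Less (ord_sum L0 L1) \<longleftrightarrow>
    i < j \<or> i = j \<and> (x, y) \<in> Less (if i = 0 then L0 else L1)"
  using assms by (auto simp: ord_sum_def Let_def)

lemma Less_ord_prod_iff:
  assumes "x \<in> Dom L1" "a \<in> Dom L0" "y \<in> Dom L1" "b \<in> Dom L0"
  shows "((x, a), (y, b)) \<in> Less (ord_prod L0 L1) \<longleftrightarrow>
    (x, y) \<in> Less L1 \<or> x = y \<and> (a, b) \<in> Less L0"
  using assms by (auto simp: ord_prod_def Let_def)

lemma Dom_ord_prod: "Dom (ord_prod L0 L1) = Dom L1 \<times> Dom L0"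
  by (simp add: ord_prod_def)

text \<open>A pair \<open>(i, \<theta>)\<close> with \<open>\<theta>\<close> mapping into summand
  \<open>i\<close> represents the class of \<open>\<theta>\<close> tagged with \<open>i\<close> on
  the left and the class of \<open>\<theta>\<close> in summand \<open>i\<close> on the right.
  Cohesiveness ensures that the left side is exhausted.\<close>

lemma cohesive_power_sum:
  assumes "cohesive C"
  shows "cohesive_power C (ord_code (ord_sum L0 L1)) \<cong>\<^sub>o
    ord_sum (cohesive_power C L0) (cohesive_power C L1)"
proof -
  define L where "L i = (if i = (0::nat) then L0 else L1)" for i
  let ?F = "cohesive_filter C" and ?S = "ord_code (ord_sum L0 L1)"
  let ?M = "ord_sum (cohesive_power C L0) (cohesive_power C L1)"
  define A where "A = (SIGMA i:{0, 1}. cp_funs C (L i))"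
  define J where "J i \<theta> = pair_fun (\<lambda>_. Some i) \<theta>" for i \<theta>
  define p where "p = (\<lambda>(i, \<theta>). cp_eq C ?S `` {J i \<theta>})"
  define q where "q = (\<lambda>(i, \<theta>). (i, cp_eq C (L i) `` {\<theta>}))"
  have J_Some: "J i \<theta> x = Some z \<longleftrightarrow> (\<exists>a. \<theta> x = Some a \<and> z = prod_encode (i, a))" for i \<theta> x z
    by (auto simp: J_def pair_fun_eq_Some)
  have in_S: "prod_encode (i, a) \<in> Dom ?S \<longleftrightarrow> i \<in> {0, 1} \<and> a \<in> Dom (L i)" for i a
    by (simp add: Dom_ord_code_iff Dom_ord_sum_iff L_def)
  have J_cp: "J i \<theta> \<in> cp_funs C ?S" if "(i, \<theta>) \<in> A" for i \<theta>
    unfolding cp_funs_iff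
  proof (intro conjI)
    have \<theta>: "i \<in> {0, 1}" "\<theta> \<in> cp_funs C (L i)" using that by (auto simp: A_def)
    then show "partial_computable (J i \<theta>)"
      by (simp add: J_def cp_funs_iff partial_computable_pair_fun partial_computable_const)
    have "a \<in> Dom (L i)" if "\<theta> x = Some a" for x a
      using \<theta>(2) that unfolding cp_funs_iff by blast
    then show "\<forall>x z. J i \<theta> x = Some z \<longrightarrow> z \<in> Dom ?S"
      using \<theta>(1) by (metis J_Some in_S)
    show "\<forall>\<^sub>F x in ?F. \<exists>z. J i \<theta> x = Some z"
      using cp_funs_eventually[OF \<theta>(2)] by eventually_elim (simp add: J_Some, blast)
  qed
  have "\<exists>a\<in>A. p a = cp_eq C ?S `` {\<phi>}" if \<phi>: "\<phi> \<in> cp_funs C ?S" for \<phi>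
  proof -
    have pc: "partial_computable (component_fun i \<phi>)" for i
      using \<phi> by (simp add: cp_funs_iff partial_computable_component_fun)
    have ev: "\<forall>\<^sub>F x in ?F. \<exists>i a. \<phi> x = Some (prod_encode (i, a)) \<and> i \<in> {0, 1}"
      using cp_funs_eventually[OF \<phi>] by eventually_elim (metis Dom_ord_codeE in_S)
    \<comment> \<open>This domain is the set of places where \<open>\<phi>\<close> takes a value in
      the first summand.\<close>
    have "ce_set (dom (component_fun 0 \<phi>))"
      using pc ce_set_def by blast
    then have "(\<forall>\<^sub>F x in ?F. x \<in> dom (component_fun 0 \<phi>)) \<or>
        (\<forall>\<^sub>F x in ?F. x \<notin> dom (component_fun 0 \<phi>))"
      by (rule cohesive_decides[OF assms])
    then have "\<exists>i\<in>{0, 1}. \<forall>\<^sub>F x in ?F. \<exists>a. \<phi> x = Some (prod_encode (i, a))"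
    proof
      assume "\<forall>\<^sub>F x in ?F. x \<in> dom (component_fun 0 \<phi>)"
      then show ?thesis by (auto simp: dom_def component_fun_eq_Some)
    next
      assume "\<forall>\<^sub>F x in ?F. x \<notin> dom (component_fun 0 \<phi>)"
      with ev have "\<forall>\<^sub>F x in ?F. \<exists>a. \<phi> x = Some (prod_encode (1, a))"
        by eventually_elim
          (metis component_fun_eq_Some domI insertE singletonD)
      then show ?thesis by blast
    qed
    then obtain i where i: "i \<in> {0, 1}"
        and ev: "\<forall>\<^sub>F x in ?F. \<exists>a. \<phi> x = Some (prod_encode (i, a))"
      by blast
    have "a \<in> Dom (L i)" if "\<phi> x = Some (prod_encode (i, a))" for x a
      using \<phi> that in_S unfolding cp_funs_iff by blast
    then have "component_fun i \<phi> \<in> cp_funs C (L i)"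
      using ev pc by (simp add: cp_funs_iff component_fun_eq_Some)
    with i have A: "(i, component_fun i \<phi>) \<in> A" by (simp add: A_def)
    \<comment> \<open>The rebuilt function diverges wherever \<open>\<phi>\<close> has the other
      tag, so in general only the classes coincide, not the functions.\<close>
    have "\<forall>\<^sub>F x in ?F. \<exists>z. J i (component_fun i \<phi>) x = Some z \<and> \<phi> x = Some z"
      using ev by eventually_elim (auto simp: J_Some component_fun_eq_Some)
    then have "p (i, component_fun i \<phi>) = cp_eq C ?S `` {\<phi>}"
      using cp_class_eq_iff[OF J_cp[OF A] \<phi>] by (simp add: p_def)
    with A show ?thesis by blast
  qed
  then have p: "p ` A = Dom (cohesive_power C ?S)"
    unfolding Dom_cohesive_power using J_cp by (fastforce simp: p_def)
  have q: "q ` A = Dom ?M"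
  proof (intro equalityI subsetI)
    fix m assume "m \<in> q ` A"
    then show "m \<in> Dom ?M"
      by (auto simp: q_def A_def L_def ord_sum_def Dom_cohesive_power)
  next
    fix m assume "m \<in> Dom ?M"
    then obtain i \<theta> where "m = q (i, \<theta>)" "(i, \<theta>) \<in> A"
      by (fastforce simp: q_def A_def L_def ord_sum_def Dom_cohesive_power)
    then show "m \<in> q ` A" by blast
  qed
  have q_Dom: "(i, cp_eq C (L i) `` {\<theta>}) \<in> Dom ?M" if "(i, \<theta>) \<in> A" for i \<theta>
    using that q by (force simp: q_def)
  have L_power: "(if i = 0 then cohesive_power C L0 else cohesive_power C L1) =
      cohesive_power C (L i)" for i
    by (simp add: L_def)
  show ?thesis
  proof (rule ord_isomorphic_via_representatives[OF p q])
    fix a b assume A: "a \<in> A" "b \<in> A"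
    obtain i \<theta> j \<eta> where [simp]: "a = (i, \<theta>)" "b = (j, \<eta>)" by (metis surj_pair)
    have cp: "\<theta> \<in> cp_funs C (L i)" "\<eta> \<in> cp_funs C (L j)" and ij: "i \<in> {0, 1}" "j \<in> {0, 1}"
      using A by (auto simp: A_def)
    \<comment> \<open>The condition \<open>i = j\<close> does not depend on \<open>x\<close>; it
      leaves the scope of \<open>eventually\<close> in the next step because the filter is
      proper.\<close>
    have "p a = p b \<longleftrightarrow> (\<forall>\<^sub>F x in ?F. i = j \<and> (\<exists>u. \<theta> x = Some u \<and> \<eta> x = Some u))"
      using cp_class_eq_iff[OF J_cp J_cp, of i \<theta> j \<eta>] A
      by (auto simp: p_def J_Some elim!: eventually_mono)
    also have "\<dots> \<longleftrightarrow> q a = q b"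
      using cp_class_eq_iff[OF cp(1), of \<eta>] cp
      by (cases "i = j") (auto simp: q_def cohesive_filter_neq_bot[OF assms])
    finally show "p a = p b \<longleftrightarrow> q a = q b" .
    \<comment> \<open>For \<open>i < j\<close> the order between summands says nothing about
      \<open>\<theta>\<close> and \<open>\<eta>\<close>, so their convergence and domain membership
      have to be supplied here.\<close>
    have ev: "\<forall>\<^sub>F x in ?F. (\<exists>u. \<theta> x = Some u \<and> u \<in> Dom (L i)) \<and>
        (\<exists>v. \<eta> x = Some v \<and> v \<in> Dom (L j))"
      using cp_funs_eventually[OF cp(1)] cp_funs_eventually[OF cp(2)] by (rule eventually_conj)
    have less: "(prod_encode (i, u), prod_encode (j, v)) \<in> Less ?S \<longleftrightarrow>
        i < j \<or> i = j \<and> (u, v) \<in> Less (L i)"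
      if "u \<in> Dom (L i)" "v \<in> Dom (L j)" for u v
      using that ij by (simp add: Less_ord_code_iff Less_ord_sum_iff Dom_ord_sum_iff L_def)
    have "(p a, p b) \<in> Less (cohesive_power C ?S) \<longleftrightarrow>
        (\<forall>\<^sub>F x in ?F. \<exists>u v. J i \<theta> x = Some u \<and> J j \<eta> x = Some v \<and> (u, v) \<in> Less ?S)"
      using Less_cohesive_power_iff[OF J_cp J_cp, of i \<theta> j \<eta>] A by (simp add: p_def)
    also have "\<dots> \<longleftrightarrow> (\<forall>\<^sub>F x in ?F. i < j \<or>
        i = j \<and> (\<exists>u v. \<theta> x = Some u \<and> \<eta> x = Some v \<and> (u, v) \<in> Less (L i)))"
      by (rule eventually_cong[OF ev]) (use less in \<open>auto simp: J_Some\<close>)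
    also have "\<dots> \<longleftrightarrow> i < j \<or> i = j \<and>
        (\<forall>\<^sub>F x in ?F. \<exists>u v. \<theta> x = Some u \<and> \<eta> x = Some v \<and> (u, v) \<in> Less (L i))"
      by (cases i j rule: linorder_cases) (auto simp: cohesive_filter_neq_bot[OF assms])
    also have "\<dots> \<longleftrightarrow> (q a, q b) \<in> Less ?M"
      using Less_ord_sum_iff[OF q_Dom q_Dom, of i \<theta> j \<eta>] A
        Less_cohesive_power_iff[OF cp(1), of \<eta>] cp
      by (auto simp: q_def L_power)
    finally show "(p a, p b) \<in> Less (cohesive_power C ?S) \<longleftrightarrow> (q a, q b) \<in> Less ?M" .
  qed
qed

text \<open>Pairs of representatives represent both sides, with the \<open>L1\<close> component
  first. The difficulty is the lexicographic order, whose disjunction must be moved out of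
  \<open>eventually\<close>.\<close>

lemma cohesive_power_prod:
  assumes "cohesive C" "irrefl (Less L1)"
  shows "cohesive_power C (ord_code (ord_prod L0 L1)) \<cong>\<^sub>o
    ord_prod (cohesive_power C L0) (cohesive_power C L1)"
proof -
  let ?F = "cohesive_filter C" and ?S = "ord_code (ord_prod L0 L1)"
  let ?M = "ord_prod (cohesive_power C L0) (cohesive_power C L1)"
  define A where "A = cp_funs C L1 \<times> cp_funs C L0"
  define p where "p = (\<lambda>(\<theta>, \<eta>). cp_eq C ?S `` {pair_fun \<theta> \<eta>})"
  define q where "q = (\<lambda>(\<theta>, \<eta>). (cp_eq C L1 `` {\<theta>}, cp_eq C L0 `` {\<eta>}))"
  have in_S: "prod_encode (u, v) \<in> Dom ?S \<longleftrightarrow> u \<in> Dom L1 \<and> v \<in> Dom L0" for u v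
    by (simp add: Dom_ord_code_iff Dom_ord_prod)
  have pair_cp: "pair_fun \<theta> \<eta> \<in> cp_funs C ?S" if "(\<theta>, \<eta>) \<in> A" for \<theta> \<eta>
    unfolding cp_funs_iff
  proof (intro conjI)
    have cp: "\<theta> \<in> cp_funs C L1" "\<eta> \<in> cp_funs C L0" using that by (auto simp: A_def)
    then show "partial_computable (pair_fun \<theta> \<eta>)"
      by (simp add: cp_funs_iff partial_computable_pair_fun)
    show "\<forall>x a. pair_fun \<theta> \<eta> x = Some a \<longrightarrow> a \<in> Dom ?S"
      using cp by (auto simp: cp_funs_iff pair_fun_eq_Some in_S)
    show "\<forall>\<^sub>F x in ?F. \<exists>a. pair_fun \<theta> \<eta> x = Some a"
      using cp_funs_eventually[OF cp(1)] cp_funs_eventually[OF cp(2)]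
      by eventually_elim (auto simp: pair_fun_eq_Some)
  qed
  have "\<exists>a\<in>A. p a = cp_eq C ?S `` {\<phi>}" if \<phi>: "\<phi> \<in> cp_funs C ?S" for \<phi>
  proof -
    define \<theta> where "\<theta> = (\<lambda>x. map_option (fst \<circ> prod_decode) (\<phi> x))"
    define \<eta> where "\<eta> = (\<lambda>x. map_option (snd \<circ> prod_decode) (\<phi> x))"
    have "partial_computable \<theta>" "partial_computable \<eta>"
      using \<phi> unfolding \<theta>_def \<eta>_def
      by (auto simp: cp_funs_iff intro: partial_computable_map_fst partial_computable_map_snd)
    moreover have "fst (prod_decode z) \<in> Dom L1" "snd (prod_decode z) \<in> Dom L0"
      if "\<phi> x = Some z" for x z
      using that \<phi> in_S[of "fst (prod_decode z)" "snd (prod_decode z)"]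
      by (auto simp: cp_funs_iff)
    moreover have "\<forall>\<^sub>F x in ?F. \<exists>a. \<phi> x = Some a"
      using \<phi> by (simp add: cp_funs_iff)
    ultimately have "(\<theta>, \<eta>) \<in> A"
      by (auto simp: A_def cp_funs_iff \<theta>_def \<eta>_def elim: eventually_mono)
    \<comment> \<open>Both coordinate functions diverge exactly where \<open>\<phi>\<close> does, so
      here the function itself is recovered.\<close>
    moreover have "pair_fun \<theta> \<eta> x = \<phi> x" for x
      by (cases "\<phi> x") (simp_all add: pair_fun_def \<theta>_def \<eta>_def)
    then have "pair_fun \<theta> \<eta> = \<phi>" ..
    then have "p (\<theta>, \<eta>) = cp_eq C ?S `` {\<phi>}"
      by (simp add: p_def)
    ultimately show ?thesis by blast
  qed
  then have p: "p ` A = Dom (cohesive_power C ?S)"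
    unfolding Dom_cohesive_power using pair_cp by (fastforce simp: p_def)
  have q: "q ` A = Dom ?M"
    by (auto simp: q_def A_def Dom_ord_prod Dom_cohesive_power)
  show ?thesis
  proof (rule ord_isomorphic_via_representatives[OF p q])
    fix a b assume A: "a \<in> A" "b \<in> A"
    obtain \<theta> \<eta> \<theta>' \<eta>' where [simp]: "a = (\<theta>, \<eta>)" "b = (\<theta>', \<eta>')" by (metis surj_pair)
    have cp: "\<theta> \<in> cp_funs C L1" "\<theta>' \<in> cp_funs C L1" "\<eta> \<in> cp_funs C L0" "\<eta>' \<in> cp_funs C L0"
      using A by (auto simp: A_def)
    let ?e = "\<lambda>x. \<exists>u. \<theta> x = Some u \<and> \<theta>' x = Some u"
    let ?l1 = "\<lambda>x. \<exists>u u'. \<theta> x = Some u \<and> \<theta>' x = Some u' \<and> (u, u') \<in> Less L1"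
    let ?l0 = "\<lambda>x. \<exists>v v'. \<eta> x = Some v \<and> \<eta>' x = Some v' \<and> (v, v') \<in> Less L0"
    have "p a = p b \<longleftrightarrow> (\<forall>\<^sub>F x in ?F. ?e x \<and> (\<exists>v. \<eta> x = Some v \<and> \<eta>' x = Some v))"
      using cp_class_eq_iff[OF pair_cp pair_cp, of \<theta> \<eta> \<theta>' \<eta>'] A
      by (auto simp: p_def pair_fun_eq_Some elim!: eventually_mono)
    also have "\<dots> \<longleftrightarrow> q a = q b"
      using cp by (simp add: q_def cp_class_eq_iff eventually_conj_iff)
    finally show "p a = p b \<longleftrightarrow> q a = q b" .
    have ev: "\<forall>\<^sub>F x in ?F. (\<exists>u. \<theta> x = Some u \<and> u \<in> Dom L1) \<and>
        (\<exists>u. \<theta>' x = Some u \<and> u \<in> Dom L1) \<and> (\<exists>v. \<eta> x = Some v \<and> v \<in> Dom L0) \<and>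
        (\<exists>v. \<eta>' x = Some v \<and> v \<in> Dom L0)"
      using cp by (intro eventually_conj cp_funs_eventually)
    have "(p a, p b) \<in> Less (cohesive_power C ?S) \<longleftrightarrow> (\<forall>\<^sub>F x in ?F. \<exists>u v.
        pair_fun \<theta> \<eta> x = Some u \<and> pair_fun \<theta>' \<eta>' x = Some v \<and> (u, v) \<in> Less ?S)"
      using Less_cohesive_power_iff[OF pair_cp pair_cp, of \<theta> \<eta> \<theta>' \<eta>'] A by (simp add: p_def)
    also have "\<dots> \<longleftrightarrow> (\<forall>\<^sub>F x in ?F. ?l1 x \<or> ?e x \<and> ?l0 x)"
      by (rule eventually_cong[OF ev])
        (auto simp: pair_fun_eq_Some Less_ord_code_iff Less_ord_prod_iff)
    also have "\<dots> \<longleftrightarrow> (\<forall>\<^sub>F x in ?F. ?l1 x) \<or> (\<forall>\<^sub>F x in ?F. ?e x) \<and> (\<forall>\<^sub>F x in ?F. ?l0 x)"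
    proof
      assume *: "\<forall>\<^sub>F x in ?F. ?l1 x \<or> ?e x \<and> ?l0 x"
      \<comment> \<open>In general \<open>eventually\<close> does not distribute over a disjunction.
        Deciding whether the first coordinates eventually agree selects the disjunct.\<close>
      have "ce_set {x. ?e x}"
        using cp by (auto simp: cp_funs_iff intro: ce_set_agree)
      from cohesive_decides[OF assms(1) this]
      show "(\<forall>\<^sub>F x in ?F. ?l1 x) \<or> (\<forall>\<^sub>F x in ?F. ?e x) \<and> (\<forall>\<^sub>F x in ?F. ?l0 x)"
      proof
        assume e: "\<forall>\<^sub>F x in ?F. x \<in> {x. ?e x}"
        \<comment> \<open>Where the first coordinates agree, irreflexivity of \<open>Less L1\<close>
          rules out \<open>?l1\<close>.\<close>
        with * have "\<forall>\<^sub>F x in ?F. ?l0 x"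
          by eventually_elim (use assms(2) in \<open>auto simp: irrefl_def\<close>)
        with e show ?thesis by simp
      next
        assume "\<forall>\<^sub>F x in ?F. x \<notin> {x. ?e x}"
        with * have "\<forall>\<^sub>F x in ?F. ?l1 x" by eventually_elim auto
        then show ?thesis ..
      qed
    next
      assume "(\<forall>\<^sub>F x in ?F. ?l1 x) \<or> (\<forall>\<^sub>F x in ?F. ?e x) \<and> (\<forall>\<^sub>F x in ?F. ?l0 x)"
      then show "\<forall>\<^sub>F x in ?F. ?l1 x \<or> ?e x \<and> ?l0 x"
        by (auto simp: eventually_conj_iff[symmetric] elim: eventually_mono)
    qed
    also have "\<dots> \<longleftrightarrow> (q a, q b) \<in> Less ?M"
      using cp
      by (simp add: q_def Less_ord_prod_iff Dom_cohesive_power cp_class_eq_iff Less_cohesive_power_iff)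
    finally show "(p a, p b) \<in> Less (cohesive_power C ?S) \<longleftrightarrow> (q a, q b) \<in> Less ?M" .
  qed
qed

text \<open>Reversal leaves the domain unchanged, hence also the representatives and their classes.
  The same class map therefore serves both sides.\<close>

lemma cohesive_power_reverse:
  "cohesive_power C (ord_reverse L) \<cong>\<^sub>o ord_reverse (cohesive_power C L)"
proof -
  have funs: "cp_funs C (ord_reverse L) = cp_funs C L"
    by (simp add: cp_funs_def ord_reverse_def)
  have eq: "cp_eq C (ord_reverse L) = cp_eq C L"
    by (simp add: cp_eq_def funs)
  show ?thesis
  proof (rule ord_isomorphic_via_representatives)
    show "(\<lambda>\<phi>. cp_eq C L `` {\<phi>}) ` cp_funs C L = Dom (cohesive_power C (ord_reverse L))"
      by (simp add: Dom_cohesive_power funs eq)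
    show "(\<lambda>\<phi>. cp_eq C L `` {\<phi>}) ` cp_funs C L = Dom (ord_reverse (cohesive_power C L))"
      by (simp add: Dom_cohesive_power ord_reverse_def)
    fix \<phi> \<psi> assume cp: "\<phi> \<in> cp_funs C L" "\<psi> \<in> cp_funs C L"
    \<comment> \<open>The quantifiers and conjuncts are reordered to match
      \<open>Less_cohesive_power_iff\<close> with \<open>\<phi>\<close> and \<open>\<psi>\<close>
      exchanged.\<close>
    have "(\<exists>a b. \<phi> x = Some a \<and> \<psi> x = Some b \<and> (a, b) \<in> Less (ord_reverse L)) \<longleftrightarrow>
        (\<exists>b a. \<psi> x = Some b \<and> \<phi> x = Some a \<and> (b, a) \<in> Less L)" for x
      by (auto simp: ord_reverse_def)
    then show "(cp_eq C L `` {\<phi>}, cp_eq C L `` {\<psi>}) \<in> Less (cohesive_power C (ord_reverse L)) \<longleftrightarrow>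
        (cp_eq C L `` {\<phi>}, cp_eq C L `` {\<psi>}) \<in> Less (ord_reverse (cohesive_power C L))"
      using Less_cohesive_power_iff[of \<phi> C "ord_reverse L" \<psi>] Less_cohesive_power_iff[OF cp(2) cp(1)] cp
      by (simp add: funs eq) (simp add: ord_reverse_def)
  qed simp
qed

theorem theorem3p6:
  fixes L0 L1 :: "nat ord_struct" and C :: "nat set"
  assumes "computable_linear_order L0"
    and "computable_linear_order L1"
    and "cohesive C"
  shows "cohesive_power C (ord_code (ord_sum L0 L1)) \<cong>\<^sub>o
           ord_sum (cohesive_power C L0) (cohesive_power C L1)
       \<and> cohesive_power C (ord_code (ord_prod L0 L1)) \<cong>\<^sub>o
           ord_prod (cohesive_power C L0) (cohesive_power C L1)
       \<and> cohesive_power C (ord_reverse L0) \<cong>\<^sub>o ord_reverse (cohesive_power C L0)"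
proof -
  have "irrefl (Less L1)"
    using assms(2)
    by (auto simp: computable_linear_order_def is_linear_order_def strict_linear_order_on_def)
  then show ?thesis
    using assms(3) by (simp add: cohesive_power_sum cohesive_power_prod cohesive_power_reverse)
qed

end
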